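(* Let $\Omega\subset\mathbb{R}^\nu$ be a bounded Lipschitz domain with outward unit normal $\mathbf n$, $k>0$, and $f\in L^2(\Omega)$ complex-valued. Consider the complex Lagrangian defined on $H^1(\Omega;\mathbb{C})$ by $$\mathcal{E}_{P,\mathbb{C}}(v)=\mathcal{E}_{P,\mathbb{C}}(v,\overline v)=\int_\Omega\frac12\big(\nabla v\cdot\nabla\overline v-k^2v\overline v\big)\,dx-\Re\int_\Omega f\,\overline v\,dx-\frac{ik}{2}\int_{\partial\Omega}v\overline v\,dS .$$ The stationary points $u$ of $\mathcal{E}_{P,\mathbb{C}}$ with respect to $\overline v$ satisfy $$\int_\Omega\nabla u\cdot\nabla\overline v\,dx-k^2\int_\Omega u\overline v\,dx-ik\int_{\partial\Omega}u\overline v\,dS=\int_\Omega f\,\overline v\,dx\qquad\text{for all }v\in H^1(\Omega;\mathbb{C}),$$ i.e. they are weak solutions of the Helmholtz problem $-\Delta u-k^2u=f$ in $\Omega$, $\partial_{\mathbf n}u=iku$ on $\partial\Omega$.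
   Context: Stationarity with respect to $\overline v$ is in the sense of the Wirtinger derivative: regard $\mathcal{E}_{P,\mathbb{C}}(v,\overline v)$ as a function of independent variables $v,\overline v$ (with $\Re(f\overline v)=\tfrac12(f\overline v+\overline f v)$), and say $u\in H^1(\Omega;\mathbb{C})$ is a stationary point with respect to $\overline v$ if $\frac{d}{d\epsilon}\mathcal{E}_{P,\mathbb{C}}(u,\overline u+\epsilon\overline w)|_{\epsilon=0}=0$ for all $w\in H^1(\Omega;\mathbb{C})$. Equivalently, $\frac12\big(\frac{d}{d\epsilon}\mathcal{E}_{P,\mathbb{C}}(u+\epsilon w)+i\frac{d}{d\epsilon}\mathcal{E}_{P,\mathbb{C}}(u+i\epsilon w)\big)|_{\epsilon=0}=0$ with real $\epsilon$, for all $w$. Boundary values are traces. *)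

theory Defs
  imports "HOL-Analysis.Analysis"
begin

section \<open>Bounded Lipschitz domains\<close>

text \<open>Near each boundary point the domain lies strictly above the graph of a Lipschitz function,
  in the direction of some unit vector \<open>e\<close>. The graph function is applied to the component of
  \<open>x\<close> orthogonal to \<open>e\<close>.\<close>

definition bounded_lipschitz_domain :: "(real^'n) set \<Rightarrow> bool" where
  "bounded_lipschitz_domain \<Omega> \<longleftrightarrow>
     open \<Omega> \<and> connected \<Omega> \<and> \<Omega> \<noteq> {} \<and> bounded \<Omega> \<and>
     (\<forall>x0 \<in> frontier \<Omega>. \<exists>r>0. \<exists>e L. \<exists>\<gamma> :: real^'n \<Rightarrow> real.
        norm e = 1 \<and> L-lipschitz_on {y. y \<bullet> e = 0} \<gamma> \<and>
        \<Omega> \<inter> ball x0 r = {x \<in> ball x0 r. x \<bullet> e > \<gamma> (x - (x \<bullet> e) *\<^sub>R e)})"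


section \<open>Surface measure\<close>

text \<open>The surface measure \<open>dS\<close> is the Hausdorff measure of dimension \<open>\<nu> - 1\<close>, normalised by
  the volume of the unit ball so that it agrees with area on flat pieces. Empty covering sets
  contribute nothing, also in dimension \<open>0\<close>, where \<open>0 ^ 0 = 1\<close>. Covering sets are
  required to be bounded because \<^const>\<open>diameter\<close> is unspecified on unbounded sets.\<close>

definition hausdorff_pre :: "nat \<Rightarrow> real \<Rightarrow> 'a::metric_space set \<Rightarrow> ennreal" where
  "hausdorff_pre s \<delta> A =
     (INF C \<in> {C :: nat \<Rightarrow> 'a set.
                 A \<subseteq> (\<Union>j. C j) \<and> (\<forall>j. bounded (C j) \<and> diameter (C j) \<le> \<delta>)}.
        \<Sum>j. if C j = {} then 0
             else ennreal (unit_ball_vol (real s) * (diameter (C j) / 2) ^ s))"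

definition hausdorff_outer :: "nat \<Rightarrow> 'a::metric_space set \<Rightarrow> ennreal" where
  "hausdorff_outer s A = (SUP \<delta> \<in> {0<..}. hausdorff_pre s \<delta> A)"

definition hausdorff_measure :: "nat \<Rightarrow> 'a::metric_space measure" where
  "hausdorff_measure s = measure_of UNIV (sets borel) (hausdorff_outer s)"

definition surface_measure :: "(real^'n) set \<Rightarrow> (real^'n) measure" where
  "surface_measure \<Omega> = restrict_space (hausdorff_measure (CARD('n) - 1)) (frontier \<Omega>)"


section \<open>The spaces \<open>L\<^sup>2\<close> and \<open>H\<^sup>1\<close>\<close>

text \<open>Elements of \<open>L\<^sup>2\<close> and \<open>H\<^sup>1\<close> are represented by functions on the whole of
  \<open>\<real>\<^sup>\<nu>\<close>; only their values on \<open>\<Omega>\<close> (respectively on the boundary) up to null sets matter.\<close>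

definition L2 :: "'a measure \<Rightarrow> ('a \<Rightarrow> 'b::euclidean_space) set" where
  "L2 M = {f. f \<in> borel_measurable M \<and> integrable M (\<lambda>x. (norm (f x))\<^sup>2)}"

definition partial :: "'n \<Rightarrow> (real^'n \<Rightarrow> real) \<Rightarrow> real^'n \<Rightarrow> real" where
  "partial i \<phi> x = frechet_derivative \<phi> (at x) (axis i 1)"

fun Ck :: "nat \<Rightarrow> (real^'n \<Rightarrow> real) \<Rightarrow> bool" where
  "Ck 0 \<phi> \<longleftrightarrow> continuous_on UNIV \<phi>"
| "Ck (Suc m) \<phi> \<longleftrightarrow> (\<forall>x. \<phi> differentiable (at x)) \<and> (\<forall>i. Ck m (partial i \<phi>))"

definition test_function :: "(real^'n) set \<Rightarrow> (real^'n \<Rightarrow> real) \<Rightarrow> bool" where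
  "test_function \<Omega> \<phi> \<longleftrightarrow>
     (\<forall>m. Ck m \<phi>) \<and> compact (closure {x. \<phi> x \<noteq> 0}) \<and> closure {x. \<phi> x \<noteq> 0} \<subseteq> \<Omega>"

definition has_weak_gradient ::
    "(real^'n) set \<Rightarrow> (real^'n \<Rightarrow> complex) \<Rightarrow> (real^'n \<Rightarrow> complex^'n) \<Rightarrow> bool" where
  "has_weak_gradient \<Omega> u g \<longleftrightarrow>
     u \<in> L2 (lebesgue_on \<Omega>) \<and> g \<in> L2 (lebesgue_on \<Omega>) \<and>
     (\<forall>\<phi> i. test_function \<Omega> \<phi> \<longrightarrow>
        (LINT x|lebesgue_on \<Omega>. partial i \<phi> x *\<^sub>R u x) =
        - (LINT x|lebesgue_on \<Omega>. \<phi> x *\<^sub>R (g x $ i)))"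

definition H1 :: "(real^'n) set \<Rightarrow> (real^'n \<Rightarrow> complex) set" where
  "H1 \<Omega> = {u. \<exists>g. has_weak_gradient \<Omega> u g}"

definition weak_grad :: "(real^'n) set \<Rightarrow> (real^'n \<Rightarrow> complex) \<Rightarrow> real^'n \<Rightarrow> complex^'n" where
  "weak_grad \<Omega> u = (SOME g. has_weak_gradient \<Omega> u g)"

text \<open>Bilinear, without conjugation: the conjugates of the energy are always written out.\<close>

definition cdot :: "complex^'n \<Rightarrow> complex^'n \<Rightarrow> complex" where
  "cdot a b = (\<Sum>i\<in>UNIV. a $ i * b $ i)"


section \<open>Traces\<close>

text \<open>The trace operator is the bounded linear operator from \<open>H\<^sup>1(\<Omega>)\<close> to
  \<open>L\<^sup>2(\<partial>\<Omega>)\<close> that restricts functions continuous up to the boundary to the boundary.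
  By the trace theorem it exists for every bounded Lipschitz domain, and it is unique up to null
  sets of the surface measure. The value \<open>0\<close> in the definition of \<open>boundary_trace\<close> is the usual
  convention for an undefined object; it is never used on a bounded Lipschitz domain.\<close>

definition is_trace_operator ::
    "(real^'n) set \<Rightarrow> ((real^'n \<Rightarrow> complex) \<Rightarrow> real^'n \<Rightarrow> complex) \<Rightarrow> bool" where
  "is_trace_operator \<Omega> T \<longleftrightarrow>
     (\<forall>u \<in> H1 \<Omega>. T u \<in> L2 (surface_measure \<Omega>)) \<and>
     (\<forall>u \<in> H1 \<Omega>. \<forall>w \<in> H1 \<Omega>. \<forall>c.
        AE x in surface_measure \<Omega>. T (\<lambda>y. u y + c * w y) x = T u x + c * T w x) \<and>
     (\<exists>C. \<forall>u \<in> H1 \<Omega>.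
        (LINT x|surface_measure \<Omega>. (norm (T u x))\<^sup>2) \<le>
        C * ((LINT x|lebesgue_on \<Omega>. (norm (u x))\<^sup>2) +
             (LINT x|lebesgue_on \<Omega>. (norm (weak_grad \<Omega> u x))\<^sup>2))) \<and>
     (\<forall>u \<in> H1 \<Omega>. continuous_on (closure \<Omega>) u \<longrightarrow>
        (AE x in surface_measure \<Omega>. T u x = u x))"

definition boundary_trace :: "(real^'n) set \<Rightarrow> (real^'n \<Rightarrow> complex) \<Rightarrow> real^'n \<Rightarrow> complex" where
  "boundary_trace \<Omega> = (if \<exists>T. is_trace_operator \<Omega> T then (SOME T. is_trace_operator \<Omega> T) else (\<lambda>u x. 0))"


section \<open>The complex Lagrangian and its stationary points\<close>

definition energy ::
    "(real^'n) set \<Rightarrow> real \<Rightarrow> (real^'n \<Rightarrow> complex) \<Rightarrow> (real^'n \<Rightarrow> complex) \<Rightarrow> complex" where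
  "energy \<Omega> k f v =
     (LINT x|lebesgue_on \<Omega>.
        1/2 * (cdot (weak_grad \<Omega> v x) (weak_grad \<Omega> (\<lambda>y. cnj (v y)) x)
               - (of_real k)\<^sup>2 * v x * cnj (v x)))
     - of_real (Re (LINT x|lebesgue_on \<Omega>. f x * cnj (v x)))
     - \<i> * of_real k / 2 *
         (LINT x|surface_measure \<Omega>. boundary_trace \<Omega> v x * boundary_trace \<Omega> (\<lambda>y. cnj (v y)) x)"

text \<open>The same Lagrangian as a function of two independent variables \<open>v\<close> and \<open>z\<close>,
  where \<open>z\<close> takes the place of the conjugate of \<open>v\<close>, and the real part of
  \<open>\<integral> f z\<close> is replaced by half of \<open>\<integral> f z + \<integral> cnj f v\<close>.\<close>

definition energy2 ::
    "(real^'n) set \<Rightarrow> real \<Rightarrow> (real^'n \<Rightarrow> complex) \<Rightarrow>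
     (real^'n \<Rightarrow> complex) \<Rightarrow> (real^'n \<Rightarrow> complex) \<Rightarrow> complex" where
  "energy2 \<Omega> k f v z =
     (LINT x|lebesgue_on \<Omega>.
        1/2 * (cdot (weak_grad \<Omega> v x) (weak_grad \<Omega> z x) - (of_real k)\<^sup>2 * v x * z x))
     - 1/2 * ((LINT x|lebesgue_on \<Omega>. f x * z x) + (LINT x|lebesgue_on \<Omega>. cnj (f x) * v x))
     - \<i> * of_real k / 2 * (LINT x|surface_measure \<Omega>. boundary_trace \<Omega> v x * boundary_trace \<Omega> z x)"

lemma energy_eq_energy2: "energy \<Omega> k f v = energy2 \<Omega> k f v (\<lambda>x. cnj (v x))"
proof -
  have "(LINT x|lebesgue_on \<Omega>. cnj (f x) * v x) = cnj (LINT x|lebesgue_on \<Omega>. f x * cnj (v x))"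
    by (subst Bochner_Integration.integral_cnj [symmetric]) simp
  then have "of_real (Re (LINT x|lebesgue_on \<Omega>. f x * cnj (v x))) =
      1/2 * ((LINT x|lebesgue_on \<Omega>. f x * cnj (v x)) + (LINT x|lebesgue_on \<Omega>. cnj (f x) * v x))"
    by (simp add: complex_add_cnj)
  then show ?thesis
    by (simp add: energy_def energy2_def)
qed

definition stationary_wrt_conj ::
    "(real^'n) set \<Rightarrow> real \<Rightarrow> (real^'n \<Rightarrow> complex) \<Rightarrow> (real^'n \<Rightarrow> complex) \<Rightarrow> bool" where
  "stationary_wrt_conj \<Omega> k f u \<longleftrightarrow>
     u \<in> H1 \<Omega> \<and>
     (\<forall>w \<in> H1 \<Omega>.
        ((\<lambda>\<epsilon>::real. energy2 \<Omega> k f u (\<lambda>x. cnj (u x) + of_real \<epsilon> * cnj (w x)))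
           has_vector_derivative 0) (at 0))"


section \<open>Weak solutions\<close>

text \<open>Weak formulation of \<open>-\<Delta>u = F\<close> in \<open>\<Omega>\<close>, \<open>\<partial>\<^sub>n u = g\<close> on the boundary, with
  \<open>n\<close> the outward unit normal: multiply by the conjugate of a test function, integrate by parts,
  and replace the normal derivative in the boundary term by \<open>g\<close>.\<close>

definition weak_neumann_solution ::
    "(real^'n) set \<Rightarrow> (real^'n \<Rightarrow> complex) \<Rightarrow> (real^'n \<Rightarrow> complex) \<Rightarrow> (real^'n \<Rightarrow> complex) \<Rightarrow> bool" where
  "weak_neumann_solution \<Omega> F g u \<longleftrightarrow>
     u \<in> H1 \<Omega> \<and>
     (\<forall>v \<in> H1 \<Omega>.
        (LINT x|lebesgue_on \<Omega>. cdot (weak_grad \<Omega> u x) (weak_grad \<Omega> (\<lambda>y. cnj (v y)) x)) =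
        (LINT x|lebesgue_on \<Omega>. F x * cnj (v x)) +
        (LINT x|surface_measure \<Omega>. g x * boundary_trace \<Omega> (\<lambda>y. cnj (v y)) x))"

end

theory Submission
  imports Defs
begin

text \<open>The energy \<open>E(u, z)\<close> is affine in \<open>z\<close>, so its derivative along \<open>cnj w\<close> is the difference of
  the two sides of the weak formulation, up to the factor \<open>1/2\<close>. Since \<^const>\<open>weak_grad\<close> is a choice
  of representative, the linearity of \<open>z \<mapsto> \<nabla>z\<close> rests on the almost everywhere uniqueness of weak
  gradients, that is, on the fundamental lemma of the calculus of variations: indicators of open boxes
  are bounded pointwise limits of test functions, and boxes form a \<open>\<pi>\<close>-system generating the Borel
  sets.\<close>


section \<open>Smooth bump functions on boxes\<close>

lemma has_derivative_imp_partial: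
  assumes "(\<phi> has_derivative D) (at x)"
  shows "partial i \<phi> x = D (axis i 1)"
  unfolding partial_def using frechet_derivative_at[OF assms] by simp

text \<open>Membership in \<open>Ck (Suc m)\<close> is defined through differentiability alone, so
  continuity has to be recovered at the bottom of the induction. The product rule needs this: its
  terms mix undifferentiated factors with partial derivatives, and both must be placed in the same
  class \<open>Ck m\<close>.\<close>

lemma Ck_Suc_imp_Ck: "Ck (Suc m) \<phi> \<Longrightarrow> Ck m \<phi>"
proof (induction m arbitrary: \<phi>)
  case 0
  then show ?case
    by (auto intro!: continuous_at_imp_continuous_on differentiable_imp_continuous_within)
qed auto

lemma Ck_const: "Ck m (\<lambda>x :: real^'n. c)"
proof (induction m arbitrary: c)
  case (Suc m)
  have "partial i (\<lambda>x :: real^'n. c) = (\<lambda>x. 0)" for i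
    using has_derivative_imp_partial[OF has_derivative_const[of c]] by (intro ext) auto
  with Suc show ?case by simp
qed simp

lemma Ck_add:
  assumes "Ck m \<phi>" "Ck m \<psi>"
  shows "Ck m (\<lambda>x. \<phi> x + \<psi> x)"
  using assms
proof (induction m arbitrary: \<phi> \<psi>)
  case 0
  then show ?case by (auto intro: continuous_intros)
next
  case (Suc m)
  then have d: "\<phi> differentiable at x" "\<psi> differentiable at x" for x by auto
  have "partial i (\<lambda>x. \<phi> x + \<psi> x) = (\<lambda>x. partial i \<phi> x + partial i \<psi> x)" for i
    using has_derivative_add[OF d[unfolded frechet_derivative_works], THEN has_derivative_imp_partial]
    by (auto simp: partial_def)
  with Suc d show ?case by auto
qed

lemma Ck_mult:
  assumes "Ck m \<phi>" "Ck m \<psi>"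
  shows "Ck m (\<lambda>x. \<phi> x * \<psi> x)"
  using assms
proof (induction m arbitrary: \<phi> \<psi>)
  case 0
  then show ?case by (auto intro: continuous_intros)
next
  case (Suc m)
  then have d: "\<phi> differentiable at x" "\<psi> differentiable at x" for x by auto
  have "partial i (\<lambda>x. \<phi> x * \<psi> x) = (\<lambda>x. \<phi> x * partial i \<psi> x + partial i \<phi> x * \<psi> x)" for i
    using has_derivative_mult[OF d[unfolded frechet_derivative_works], THEN has_derivative_imp_partial]
    by (auto simp: partial_def)
  with Suc d show ?case
    using Ck_Suc_imp_Ck[of m \<phi>] Ck_Suc_imp_Ck[of m \<psi>] by (auto intro!: Ck_add Suc.IH)
qed

lemma Ck_prod:
  assumes "\<And>j. j \<in> J \<Longrightarrow> Ck m (\<phi> j)"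
  shows "Ck m (\<lambda>x. \<Prod>j\<in>J. \<phi> j x)"
  using assms by (induction J rule: infinite_finite_induct) (auto intro: Ck_const Ck_mult)

section \<open>The function exp(-1/t), flat at 0\<close>

text \<open>Allowing a polynomial factor makes the class closed under differentiation.\<close>

definition flat_exp :: "real poly \<Rightarrow> real \<Rightarrow> real" where
  "flat_exp p t = (if t \<le> 0 then 0 else poly p (1 / t) * exp (- (1 / t)))"

text \<open>The exponential dominates every monomial. Under s = 1/h this becomes the flatness of
  \<open>flat_exp\<close> at 0 from the right.\<close>

lemma poly_div_exp_tendsto_0: "((\<lambda>s. poly p s / exp s) \<longlongrightarrow> (0::real)) at_top"
proof -
  have "((\<lambda>s. \<Sum>i\<le>degree p. coeff p i * (s ^ i / exp s)) \<longlongrightarrow> (\<Sum>i\<le>degree p. coeff p i * 0)) at_top"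
    by (intro tendsto_intros tendsto_power_div_exp_0)
  then show ?thesis
    by (simp add: poly_altdef sum_divide_distrib)
qed

text \<open>With s = 1/t, the chain rule turns p(s) exp(-s) into s^2 (p(s) - p'(s)) exp(-s), since
  ds/dt = -s^2. The two \<open>pCons 0\<close> are the factor s^2.\<close>

lemma flat_exp_has_derivative:
  "(flat_exp p has_real_derivative flat_exp (pCons 0 (pCons 0 (p - pderiv p))) t) (at t)"
proof -
  let ?q = "pCons 0 (pCons 0 (p - pderiv p))"
  consider "t < 0" | "t = 0" | "t > 0" by linarith
  then show ?thesis
  proof cases
    case 1
    have "((\<lambda>_. 0) has_real_derivative 0) (at t)" by simp
    then have "(flat_exp p has_real_derivative 0) (at t)"
      by (rule has_field_derivative_transform_within_open[where S = "{..<0}"])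
         (use 1 in \<open>auto simp: flat_exp_def\<close>)
    with 1 show ?thesis by (simp add: flat_exp_def)
  next
    case 2
    \<comment> \<open>This is the difference quotient at 0, because
      \<open>flat_exp p 0 = 0\<close>.\<close>
    have "((\<lambda>h. flat_exp p h / h) \<longlongrightarrow> 0) (at 0)"
      unfolding filterlim_at_split
    proof
      have "eventually (\<lambda>h. flat_exp p h / h = 0) (at_left (0::real))"
        by (auto simp: flat_exp_def eventually_at_filter)
      then show "((\<lambda>h. flat_exp p h / h) \<longlongrightarrow> 0) (at_left 0)"
        by (rule tendsto_eventually)
      \<comment> \<open>Dividing by h = 1/s multiplies by s, which raises \<open>p\<close> to
        \<open>pCons 0 p\<close>.\<close>
      have "eventually (\<lambda>s. poly (pCons 0 p) s / exp s = flat_exp p (inverse s) / inverse s) (at_top :: real filter)"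
        using eventually_gt_at_top[of 0]
        by eventually_elim (auto simp: flat_exp_def field_simps exp_minus)
      then show "((\<lambda>h. flat_exp p h / h) \<longlongrightarrow> 0) (at_right 0)"
        unfolding filterlim_at_right_to_top
        using poly_div_exp_tendsto_0[of "pCons 0 p"] by (rule Lim_transform_eventually[rotated])
    qed
    with 2 show ?thesis
      by (simp add: DERIV_def flat_exp_def)
  next
    case 3
    have "((\<lambda>t. poly p (1 / t) * exp (- (1 / t))) has_real_derivative flat_exp ?q t) (at t)"
      using 3
      by (auto intro!: derivative_eq_intros DERIV_chain2[OF poly_DERIV]
               simp: flat_exp_def field_simps power2_eq_square)
    then show ?thesis
      by (rule has_field_derivative_transform_within_open[where S = "{0<..}"])
         (use 3 in \<open>auto simp: flat_exp_def\<close>)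
  qed
qed

text \<open>The induction must run over all \<open>p\<close>, because each partial derivative
  changes the polynomial. The inner derivative \<open>l $ i\<close> is a constant and is absorbed
  into the polynomial by \<open>smult\<close>.\<close>

lemma Ck_flat_exp: "Ck m (\<lambda>x. flat_exp p (l \<bullet> x + c))"
proof (induction m arbitrary: p)
  case 0
  have "continuous_on UNIV (flat_exp p)"
    using flat_exp_has_derivative by (intro DERIV_continuous_on) blast
  then have "continuous_on UNIV (\<lambda>x. flat_exp p (l \<bullet> x + c))"
    by (rule continuous_on_compose2) (auto intro!: continuous_intros)
  then show ?case by simp
next
  case (Suc m)
  let ?q = "pCons 0 (pCons 0 (p - pderiv p))"
  have d: "((\<lambda>x. flat_exp p (l \<bullet> x + c)) has_derivative
      (\<lambda>h. flat_exp ?q (l \<bullet> x + c) * (l \<bullet> h))) (at x)" for x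
    by (rule has_derivative_compose[where g = "flat_exp p", unfolded o_def])
       (auto intro!: derivative_eq_intros flat_exp_has_derivative[unfolded has_field_derivative_def])
  have "partial i (\<lambda>x. flat_exp p (l \<bullet> x + c)) = (\<lambda>x. flat_exp (smult (l $ i) ?q) (l \<bullet> x + c))" for i
    using has_derivative_imp_partial[OF d]
    by (auto simp: flat_exp_def inner_axis)
  with Suc d show ?case
    by (auto simp: differentiable_def)
qed

section \<open>Bump functions supported in an open box\<close>

text \<open>The shift by \<open>1\<close> keeps the support at distance \<open>1/n\<close> from the faces of the box, hence compact in
  the open box.\<close>

definition box_bump :: "real^'n \<Rightarrow> real^'n \<Rightarrow> nat \<Rightarrow> real^'n \<Rightarrow> real" where
  "box_bump a b n x = (\<Prod>i\<in>UNIV. flat_exp 1 (real n * (x $ i - a $ i) - 1) * flat_exp 1 (real n * (b $ i - x $ i) - 1))"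

lemma Ck_box_bump: "Ck m (box_bump a b n)"
proof -
  have "Ck m (\<lambda>x. flat_exp 1 (real n * (x $ i - a $ i) - 1))" for i
    using Ck_flat_exp[of m 1 "axis i (real n)" "- real n * a $ i - 1"]
    by (simp add: inner_axis' algebra_simps)
  moreover have "Ck m (\<lambda>x. flat_exp 1 (real n * (b $ i - x $ i) - 1))" for i
    using Ck_flat_exp[of m 1 "axis i (- real n)" "real n * b $ i - 1"]
    by (simp add: inner_axis' algebra_simps)
  ultimately show ?thesis
    unfolding box_bump_def[abs_def] by (intro Ck_prod Ck_mult) auto
qed

lemma flat_exp_1_bounds: "0 \<le> flat_exp 1 t" "flat_exp 1 t \<le> 1"
  by (auto simp: flat_exp_def)

lemma box_bump_bounds: "0 \<le> box_bump a b n x" "box_bump a b n x \<le> 1"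
  unfolding box_bump_def
  by (auto intro!: prod_nonneg prod_le_1 mult_nonneg_nonneg mult_le_one flat_exp_1_bounds)

text \<open>No factor of a nonzero product vanishes, so every argument of \<open>flat_exp\<close> is
  positive. For \<open>n = 0\<close> all these arguments equal -1, hence the bump is identically
  zero and \<open>n > 0\<close> follows.\<close>

lemma box_bump_nonzero_imp:
  assumes "box_bump a b n x \<noteq> 0"
  shows "n > 0" "a $ i + 1 / real n \<le> x $ i" "x $ i \<le> b $ i - 1 / real n"
proof -
  have "real n * (x $ i - a $ i) - 1 > 0" "real n * (b $ i - x $ i) - 1 > 0"
    using assms by (simp_all add: box_bump_def flat_exp_def split: if_splits) (metis not_less)+
  moreover from this show "n > 0" by (cases n) auto
  ultimately show "a $ i + 1 / real n \<le> x $ i" "x $ i \<le> b $ i - 1 / real n"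
    by (auto simp: field_simps)
qed

lemma test_function_box_bump:
  assumes "box a b \<subseteq> \<Omega>"
  shows "test_function \<Omega> (box_bump a b n)"
proof -
  let ?S = "{x. box_bump a b n x \<noteq> 0}"
  let ?C = "cbox (a + (\<chi> i. 1 / real n)) (b - (\<chi> i. 1 / real n))"
  have "?S \<subseteq> ?C"
    by (auto simp: mem_box_cart dest: box_bump_nonzero_imp)
  then have sub: "closure ?S \<subseteq> ?C"
    by (intro closure_minimal) auto
  have "closure ?S \<subseteq> box a b"
  \<comment> \<open>For \<open>n = 0\<close> the quotient \<open>1 / real n\<close> is 0 by
    convention, so \<open>?C\<close> is the whole closed box and need not lie in the open one; the
    bump then vanishes identically.\<close>
  proof (cases "n = 0")
    case True
    then have "?S = {}" by (auto dest: box_bump_nonzero_imp)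
    then show ?thesis by (simp only: closure_empty) simp
  next
    case False
    then have pos: "0 < 1 / real n" by simp
    have "?C \<subseteq> box a b"
    proof
      fix x assume "x \<in> ?C"
      then have "a $ i + 1 / real n \<le> x $ i" "x $ i \<le> b $ i - 1 / real n" for i
        by (auto simp: mem_box_cart)
      then have "a $ i < x $ i" "x $ i < b $ i" for i
        using pos by (smt (verit))+
      then show "x \<in> box a b" by (simp add: mem_box_cart)
    qed
    with sub show ?thesis by blast
  qed
  moreover have "compact (closure ?S)"
    using sub by (meson bounded_cbox bounded_subset compact_eq_bounded_closed closed_closure)
  ultimately show ?thesis
    using assms by (auto simp: test_function_def Ck_box_bump)
qed

lemma flat_exp_scaled_tendsto_1:
  assumes "0 < s"
  shows "(\<lambda>n. flat_exp 1 (real n * s - 1)) \<longlonglongrightarrow> 1"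
proof -
  have lim: "filterlim (\<lambda>n. real n * s - 1) at_top sequentially"
    using assms by (intro filterlim_tendsto_add_at_top[OF tendsto_const, of _ _ "- 1", simplified] filterlim_at_top_mult_tendsto_pos[OF tendsto_const] filterlim_real_sequentially)
  have "(\<lambda>n. exp (- (1 / (real n * s - 1)))) \<longlonglongrightarrow> exp (- 0)"
    by (intro tendsto_intros tendsto_divide_0[OF tendsto_const] filterlim_at_top_imp_at_infinity lim)
  moreover have "eventually (\<lambda>n. exp (- (1 / (real n * s - 1))) = flat_exp 1 (real n * s - 1)) sequentially"
    using filterlim_at_top_dense[THEN iffD1, OF lim, rule_format, of 0]
    by eventually_elim (simp add: flat_exp_def)
  ultimately show ?thesis
    by (simp add: Lim_transform_eventually)
qed

text \<open>Inside the box every distance to a face is positive, so the arguments tend to infinity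
  and each factor to 1. Outside, some factor is 0 for every \<open>n\<close>.\<close>

lemma box_bump_tendsto_indicator: "(\<lambda>n. box_bump a b n x) \<longlonglongrightarrow> indicator (box a b) x"
proof (cases "x \<in> box a b")
  case True
  then have "(\<lambda>n. box_bump a b n x) \<longlonglongrightarrow> (\<Prod>i\<in>(UNIV::'a set). 1 * 1)"
    unfolding box_bump_def
    by (intro tendsto_prod tendsto_mult flat_exp_scaled_tendsto_1) (auto simp: mem_box_cart)
  with True show ?thesis by simp
next
  case False
  then obtain i where "x $ i \<le> a $ i \<or> b $ i \<le> x $ i"
    by (auto simp: mem_box_cart not_less)
  then have "box_bump a b n x = 0" for n
    using box_bump_nonzero_imp[of a b n x] by (smt (verit) of_nat_0_less_iff zero_less_divide_1_iff)
  with False show ?thesis by simp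
qed


section \<open>The fundamental lemma of the calculus of variations\<close>

lemma test_function_continuous: "test_function \<Omega> \<phi> \<Longrightarrow> continuous_on UNIV \<phi>"
  unfolding test_function_def using Ck.simps(1) by blast

lemma test_function_partial_continuous: "test_function \<Omega> \<phi> \<Longrightarrow> continuous_on UNIV (partial i \<phi>)"
  unfolding test_function_def by (metis Ck.simps)

text \<open>A continuous factor is bounded on the compact closure of \<open>S\<close>. Asking only
  for continuity covers test functions and their partial derivatives alike.\<close>

lemma integrable_continuous_scaleR:
  fixes h :: "'a::euclidean_space \<Rightarrow> 'b::euclidean_space" and \<phi> :: "'a \<Rightarrow> real"
  assumes "bounded S" "integrable (lebesgue_on S) h" "continuous_on UNIV \<phi>"
  shows "integrable (lebesgue_on S) (\<lambda>x. \<phi> x *\<^sub>R h x)"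
proof -
  have "compact (\<phi> ` closure S)"
    using assms by (intro compact_continuous_image) (auto intro: continuous_on_subset simp: compact_closure)
  then obtain K where K: "\<And>x. x \<in> S \<Longrightarrow> norm (\<phi> x) \<le> K"
    using closure_subset[of S] unfolding bounded_iff
    by (metis (no_types, lifting) bounded_iff compact_imp_bounded image_eqI subsetD)
  have [measurable]: "\<phi> \<in> borel_measurable (lebesgue_on S)"
    using borel_measurable_continuous_onI[OF assms(3)] 
    by (intro measurable_restrict_space1 measurable_completion) auto
  show ?thesis
  proof (rule Bochner_Integration.integrable_bound)
    show "integrable (lebesgue_on S) (\<lambda>x. K *\<^sub>R norm (h x))"
      using assms(2) by auto
    show "(\<lambda>x. \<phi> x *\<^sub>R h x) \<in> borel_measurable (lebesgue_on S)"
      using assms(2) by measurable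
    show "AE x in lebesgue_on S. norm (\<phi> x *\<^sub>R h x) \<le> norm (K *\<^sub>R norm (h x))"
    proof (intro AE_I2)
      fix x assume "x \<in> space (lebesgue_on S)"
      then have "norm (\<phi> x) \<le> K" using K by simp
      then show "norm (\<phi> x *\<^sub>R h x) \<le> norm (K *\<^sub>R norm (h x))"
        by (auto simp: abs_mult intro!: mult_right_mono)
    qed
  qed
qed

lemma sigma_finite_lebesgue: "sigma_finite_measure (lebesgue :: 'a::euclidean_space measure)"
proof
  obtain A :: "'a set set" where A: "countable A" "A \<subseteq> sets lborel" "\<Union>A = UNIV" "\<forall>a\<in>A. emeasure lborel a \<noteq> \<infinity>"
    using lborel.sigma_finite_countable by auto
  then show "\<exists>A :: 'a set set. countable A \<and> A \<subseteq> sets lebesgue \<and> \<Union>A = space lebesgue \<and> (\<forall>a\<in>A. emeasure lebesgue a \<noteq> \<infinity>)"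
    by (intro exI[of _ A]) (auto simp: subset_eq)
qed

text \<open>The sets over which \<open>h\<close> integrates to 0 are closed under complements and
  countable disjoint unions, so Dynkin's theorem extends the hypothesis from boxes to Borel sets.
  Null sets extend it to Lebesgue sets, and a density with all integrals zero vanishes almost
  everywhere.\<close>

lemma AE_zero_if_box_integrals_zero:
  fixes h :: "'a::euclidean_space \<Rightarrow> 'b::euclidean_space"
  assumes h: "integrable lebesgue h"
    and box: "\<And>a b. (LINT x:box a b|lebesgue. h x) = 0"
  shows "AE x in lebesgue. h x = 0"
proof -
  have int: "set_integrable lebesgue D h" if "D \<in> sets lebesgue" for D
    using h that by (simp add: set_integrable_def integrable_mult_indicator)
  \<comment> \<open>The complement step needs the integral over the whole space, obtained by
    exhausting it with growing boxes.\<close>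
  have total: "(LINT x:UNIV|lebesgue. h x) = 0"
  proof -
    let ?A = "\<lambda>n::nat. box (- (real n *\<^sub>R One)) (real n *\<^sub>R One) :: 'a set"
    have "(\<lambda>n. LINT x:?A n|lebesgue. h x) \<longlonglongrightarrow> (LINT x:(\<Union>n. ?A n)|lebesgue. h x)"
      by (rule set_integral_cont_up) (auto simp: incseq_def subset_box intro!: int)
    then show ?thesis
      by (simp add: box UN_box_eq_UNIV LIMSEQ_const_iff)
  qed
  have borel: "(LINT x:D|lebesgue. h x) = 0" if "D \<in> sets borel" for D
  proof -
    have "Int_stable (range (\<lambda>(a, b). box a b :: 'a set))"
      by (auto simp: Int_stable_def box_Int_box)
    moreover have "range (\<lambda>(a, b). box a b :: 'a set) \<subseteq> Pow UNIV"
      by auto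
    moreover have "D \<in> sigma_sets UNIV (range (\<lambda>(a, b). box a b))"
      using that unfolding borel_eq_box by simp
    ultimately show ?thesis
    proof (induction rule: sigma_sets_induct_disjoint)
      case (basic A)
      then show ?case using box by auto
    next
      case empty
      then show ?case by (simp add: set_lebesgue_integral_def)
    next
      case (compl A)
      then have "A \<in> sets borel" by (simp add: borel_eq_box)
      then have [simp]: "A \<in> sets lebesgue" by auto
      have "(LINT x:A \<union> (UNIV - A)|lebesgue. h x)
          = (LINT x:A|lebesgue. h x) + (LINT x:UNIV - A|lebesgue. h x)"
        by (intro set_integral_Un int) auto
      with compl total show ?case by simp
    next
      case (union F)
      then have "\<And>i. F i \<in> sets borel" by (simp add: borel_eq_box subset_eq)
      then have "\<And>i. F i \<in> sets lebesgue" by auto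
      with union show ?case
        by (subst lebesgue_integral_countable_add) (auto simp: disjoint_family_on_def intro!: int)
    qed
  qed
  \<comment> \<open>A Lebesgue set differs from an F-sigma set, which is Borel, by a null
    set.\<close>
  have "(LINT x:D|lebesgue. h x) = 0" if D: "D \<in> sets lebesgue" for D
  proof -
    obtain C T where CT: "fsigma C" "T \<in> null_sets lebesgue" "C \<union> T = D"
      using lebesgue_set_almost_fsigma[OF D] by metis
    then have C: "C \<in> sets borel" by (auto elim: fsigma.cases)
    have "(LINT x:D|lebesgue. h x) = (LINT x:C|lebesgue. h x)"
    proof (rule set_integral_cong_set)
      show "AE x in lebesgue. (x \<in> C) = (x \<in> D)"
        using AE_not_in[OF CT(2)] by eventually_elim (use CT(3) in auto)
    qed (use int[of C] int[of D] D C in \<open>auto simp: set_integrable_def set_borel_measurable_def\<close>)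
    with borel[OF C] show ?thesis by simp
  qed
  moreover have "sigma_finite_measure (lebesgue :: 'a measure)"
    by (rule sigma_finite_lebesgue)
  ultimately show ?thesis
    using h by (intro sigma_finite_measure.density_zero)
qed

lemma fundamental_lemma_calculus_of_variations:
  fixes h :: "real^'n \<Rightarrow> 'b::euclidean_space"
  assumes "open \<Omega>" "integrable (lebesgue_on \<Omega>) h"
    and zero: "\<And>\<phi>. test_function \<Omega> \<phi> \<Longrightarrow> (LINT x|lebesgue_on \<Omega>. \<phi> x *\<^sub>R h x) = 0"
  shows "AE x in lebesgue_on \<Omega>. h x = 0"
proof -
  have [measurable]: "\<Omega> \<in> sets lebesgue" using assms(1) by auto
  have h: "set_integrable lebesgue \<Omega> h"
    using assms(2) by (simp add: set_integrable_def integrable_restrict_space)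
  \<comment> \<open>Dominated convergence along the bumps, with majorant \<open>norm (h x)\<close>
    since the bumps lie between 0 and 1.\<close>
  have box0: "(LINT x:box a b|lebesgue. h x) = 0" if sub: "box a b \<subseteq> \<Omega>" for a b
  proof -
    have "(\<lambda>n. LINT x|lebesgue_on \<Omega>. box_bump a b n x *\<^sub>R h x)
        \<longlonglongrightarrow> (LINT x|lebesgue_on \<Omega>. indicator (box a b) x *\<^sub>R h x)"
    proof (rule integral_dominated_convergence[where w = "\<lambda>x. norm (h x)"])
      have "continuous_on UNIV (box_bump a b n)" for n
        using test_function_continuous[OF test_function_box_bump[OF subset_refl]] .
      then have [measurable]: "box_bump a b n \<in> borel_measurable (lebesgue_on \<Omega>)" for n
        by (intro measurable_restrict_space1 measurable_completion)
           (auto dest: borel_measurable_continuous_onI)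
      show "(\<lambda>x. box_bump a b n x *\<^sub>R h x) \<in> borel_measurable (lebesgue_on \<Omega>)" for n
        using assms(2) by measurable
      have "indicat_real (box a b) \<in> borel_measurable (lebesgue_on \<Omega>)"
        by (intro measurable_restrict_space1 borel_measurable_indicator) auto
      then show "(\<lambda>x. indicat_real (box a b) x *\<^sub>R h x) \<in> borel_measurable (lebesgue_on \<Omega>)"
        using assms(2) by measurable
      show "AE x in lebesgue_on \<Omega>. (\<lambda>n. box_bump a b n x *\<^sub>R h x) \<longlonglongrightarrow> indicator (box a b) x *\<^sub>R h x"
        by (intro AE_I2 tendsto_scaleR box_bump_tendsto_indicator tendsto_const)
      show "AE x in lebesgue_on \<Omega>. norm (box_bump a b n x *\<^sub>R h x) \<le> norm (h x)" for n
        using box_bump_bounds[of a b n] by (intro AE_I2) (auto intro: mult_left_le_one_le)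
    qed (use assms(2) in auto)
    then have "(LINT x|lebesgue_on \<Omega>. indicat_real (box a b) x *\<^sub>R h x) = 0"
      by (simp add: zero[OF test_function_box_bump[OF sub]] LIMSEQ_const_iff)
    moreover have "indicat_real \<Omega> x * indicat_real (box a b) x = indicat_real (box a b) x" for x
      using sub by (auto simp: indicator_def)
    ultimately show ?thesis
      by (simp add: integral_restrict_space set_lebesgue_integral_def)
  qed
  \<comment> \<open>Countably many boxes fill \<Omega>, so the exceptional null sets of the single
    boxes can be united.\<close>
  obtain \<D> where \<D>: "countable \<D>" "\<D> \<subseteq> Pow \<Omega>" "\<And>X. X \<in> \<D> \<Longrightarrow> \<exists>a b. X = box a b" "\<Union>\<D> = \<Omega>"
    using open_countable_Union_open_box[OF assms(1)] by metis
  have "AE x in lebesgue. x \<in> X \<longrightarrow> h x = 0" if X: "X \<in> \<D>" for X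
  proof -
    have "AE x in lebesgue. indicat_real X x *\<^sub>R h x = 0"
    proof (rule AE_zero_if_box_integrals_zero)
      show "integrable lebesgue (\<lambda>x. indicat_real X x *\<^sub>R h x)"
        using set_integrable_subset[OF h, of X] \<D> X by (force simp: set_integrable_def)
      fix a b
      \<comment> \<open>Cutting \<open>h\<close> off outside \<open>X\<close> makes it a function on
        the whole space; its integral over any box is that of \<open>h\<close> over the intersection
        with \<open>X\<close>, again a box inside \<Omega>.\<close>
      obtain c d where cd: "box a b \<inter> X = box c d"
        using \<D>(3)[OF X] by (auto simp: box_Int_box)
      then have "(LINT x:box a b|lebesgue. indicat_real X x *\<^sub>R h x) = (LINT x:box c d|lebesgue. h x)"
        by (simp add: set_lebesgue_integral_def indicator_inter_arith flip: cd)
      also have "\<dots> = 0"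
        using box0 cd \<D>(2) X by blast
      finally show "(LINT x:box a b|lebesgue. indicat_real X x *\<^sub>R h x) = 0" .
    qed
    then show ?thesis
      by eventually_elim (auto simp: indicator_def)
  qed
  then have "AE x in lebesgue. \<forall>X\<in>\<D>. x \<in> X \<longrightarrow> h x = 0"
    using \<D>(1) by (intro AE_ball_countable')
  then have "AE x in lebesgue. x \<in> \<Omega> \<longrightarrow> h x = 0"
    by eventually_elim (use \<D>(4) in blast)
  then show ?thesis
    by (simp add: AE_restrict_space_iff)
qed


section \<open>Linearity of weak gradients and traces\<close>

lemma integral_add_scale:
  fixes f g :: "'a \<Rightarrow> complex"
  assumes "integrable M f" "integrable M g"
  shows "(LINT x|M. f x + c * g x) = (LINT x|M. f x) + c * (LINT x|M. g x)"
  using assms by simp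

lemma L2_add:
  assumes "f \<in> L2 M" "g \<in> L2 M"
  shows "(\<lambda>x. f x + g x) \<in> L2 M"
proof -
  have [measurable]: "f \<in> borel_measurable M" "g \<in> borel_measurable M"
    using assms by (auto simp: L2_def)
  have "integrable M (\<lambda>x. (norm (f x + g x))\<^sup>2)"
  proof (rule Bochner_Integration.integrable_bound)
    show "integrable M (\<lambda>x. 2 * (norm (f x))\<^sup>2 + 2 * (norm (g x))\<^sup>2)"
      using assms by (auto simp: L2_def)
    have "(norm (f x + g x))\<^sup>2 \<le> 2 * (norm (f x))\<^sup>2 + 2 * (norm (g x))\<^sup>2" for x
    proof -
      have "(norm (f x + g x))\<^sup>2 \<le> (norm (f x) + norm (g x))\<^sup>2"
        by (intro power_mono norm_triangle_ineq) auto
      also have "\<dots> \<le> 2 * (norm (f x))\<^sup>2 + 2 * (norm (g x))\<^sup>2"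
        using sum_squares_bound[of "norm (f x)" "norm (g x)"] by (simp add: power2_sum)
      finally show ?thesis .
    qed
    then show "AE x in M. norm ((norm (f x + g x))\<^sup>2) \<le> norm (2 * (norm (f x))\<^sup>2 + 2 * (norm (g x))\<^sup>2)"
      by (intro AE_I2) simp
  qed measurable
  then show ?thesis by (simp add: L2_def)
qed

text \<open>Serves scalar multiples, conjugation and coordinate projections at once.\<close>

lemma L2_bounded_linear:
  assumes T: "bounded_linear T" and f: "f \<in> L2 M"
  shows "(\<lambda>x. T (f x)) \<in> L2 M"
proof -
  have [measurable]: "f \<in> borel_measurable M" "T \<in> borel_measurable borel"
    using f T by (auto simp: L2_def intro!: borel_measurable_continuous_onI linear_continuous_on)
  obtain K where K: "\<And>x. norm (T x) \<le> norm x * K"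
    using bounded_linear.bounded[OF T] by blast
  have "integrable M (\<lambda>x. (norm (T (f x)))\<^sup>2)"
  proof (rule Bochner_Integration.integrable_bound)
    show "integrable M (\<lambda>x. K\<^sup>2 * (norm (f x))\<^sup>2)"
      using f by (auto simp: L2_def)
    show "AE x in M. norm ((norm (T (f x)))\<^sup>2) \<le> norm (K\<^sup>2 * (norm (f x))\<^sup>2)"
      using power_mono[OF K norm_ge_zero, of _ 2] by (intro AE_I2) (simp add: power_mult_distrib mult.commute)
  qed measurable
  then show ?thesis by (simp add: L2_def)
qed

lemma L2_mult_integrable:
  fixes f g :: "'a \<Rightarrow> complex"
  assumes "f \<in> L2 M" "g \<in> L2 M"
  shows "integrable M (\<lambda>x. f x * g x)"
proof (rule Bochner_Integration.integrable_bound)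
  have [measurable]: "f \<in> borel_measurable M" "g \<in> borel_measurable M"
    using assms by (auto simp: L2_def)
  show "integrable M (\<lambda>x. (norm (f x))\<^sup>2 + (norm (g x))\<^sup>2)"
    using assms by (auto simp: L2_def)
  show "(\<lambda>x. f x * g x) \<in> borel_measurable M" by measurable
  have "norm (f x) * norm (g x) \<le> (norm (f x))\<^sup>2 + (norm (g x))\<^sup>2" for x
    using sum_squares_bound[of "norm (f x)" "norm (g x)"]
      mult_nonneg_nonneg[OF norm_ge_zero norm_ge_zero, of "f x" "g x"] by linarith
  then show "AE x in M. norm (f x * g x) \<le> norm ((norm (f x))\<^sup>2 + (norm (g x))\<^sup>2)"
    by (intro AE_I2) (simp add: norm_mult)
qed

text \<open>From t \<le> 1 + t^2, where finiteness of the measure makes the constant 1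
  integrable.\<close>

lemma L2_imp_integrable:
  assumes "finite_measure M" "f \<in> L2 M"
  shows "integrable M f"
proof (rule Bochner_Integration.integrable_bound)
  interpret finite_measure M by fact
  show "integrable M (\<lambda>x. 1 + (norm (f x))\<^sup>2)"
    using assms(2) by (auto simp: L2_def)
  show "f \<in> borel_measurable M" using assms(2) by (simp add: L2_def)
  have "norm (f x) \<le> 1 + (norm (f x))\<^sup>2" for x
    using sum_squares_bound[of 1 "norm (f x)"] norm_ge_zero[of "f x"] by (simp del: norm_ge_zero)
  then show "AE x in M. norm (f x) \<le> norm (1 + (norm (f x))\<^sup>2)"
    by (intro AE_I2) simp
qed

lemma L2_nth:
  fixes f :: "'a \<Rightarrow> complex^'n"
  shows "f \<in> L2 M \<Longrightarrow> (\<lambda>x. f x $ i) \<in> L2 M"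
  by (rule L2_bounded_linear[OF bounded_linear_vec_nth])

lemma L2_cdot_integrable:
  assumes "f \<in> L2 M" "g \<in> L2 M"
  shows "integrable M (\<lambda>x. cdot (f x) (g x))"
  unfolding cdot_def using assms
  by (intro Bochner_Integration.integrable_sum L2_mult_integrable L2_nth)

lemma bounded_linear_vector_scalar_mult: "bounded_linear (\<lambda>v::complex^'n. c *s v)"
  unfolding linear_conv_bounded_linear[symmetric]
  by (intro linearI) (simp_all add: vec_eq_iff algebra_simps)

text \<open>Conjugation is linear over the reals, which is the linearity that
  \<open>bounded_linear\<close> refers to.\<close>

lemma bounded_linear_vec_cnj: "bounded_linear (\<lambda>v::complex^'n. \<chi> i. cnj (v $ i))"
  unfolding linear_conv_bounded_linear[symmetric]
  by (intro linearI) (simp_all add: vec_eq_iff)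

lemma cdot_add_scale: "cdot v (a + c *s b) = cdot v a + c * cdot v b"
  by (simp add: cdot_def sum.distrib sum_distrib_left algebra_simps)

lemma finite_measure_lebesgue_on_bounded_open:
  fixes \<Omega> :: "'a::euclidean_space set"
  shows "open \<Omega> \<Longrightarrow> bounded \<Omega> \<Longrightarrow> finite_measure (lebesgue_on \<Omega>)"
  by (intro finite_measure_lebesgue_on lmeasurable_open)

section \<open>Conjugation, linearity and uniqueness of weak gradients\<close>

text \<open>Test functions are real valued, so conjugating the defining identity conjugates only
  \<open>u\<close> and \<open>g\<close>.\<close>

lemma has_weak_gradient_cnj:
  assumes "has_weak_gradient \<Omega> u g"
  shows "has_weak_gradient \<Omega> (\<lambda>x. cnj (u x)) (\<lambda>x. \<chi> i. cnj (g x $ i))"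
  unfolding has_weak_gradient_def
proof (intro conjI allI impI)
  show "(\<lambda>x. cnj (u x)) \<in> L2 (lebesgue_on \<Omega>)"
    using assms by (intro L2_bounded_linear[OF bounded_linear_cnj]) (simp add: has_weak_gradient_def)
  show "(\<lambda>x. \<chi> i. cnj (g x $ i)) \<in> L2 (lebesgue_on \<Omega>)"
    using assms by (intro L2_bounded_linear[OF bounded_linear_vec_cnj]) (simp add: has_weak_gradient_def)
  fix \<phi> i assume "test_function \<Omega> \<phi>"
  then have "cnj (LINT x|lebesgue_on \<Omega>. partial i \<phi> x *\<^sub>R u x)
      = cnj (- (LINT x|lebesgue_on \<Omega>. \<phi> x *\<^sub>R (g x $ i)))"
    using assms by (simp add: has_weak_gradient_def)
  then show "(LINT x|lebesgue_on \<Omega>. partial i \<phi> x *\<^sub>R cnj (u x))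
      = - (LINT x|lebesgue_on \<Omega>. \<phi> x *\<^sub>R ((\<chi> i. cnj (g x $ i)) $ i))"
    by (simp flip: Bochner_Integration.integral_cnj)
qed

text \<open>Splitting the integrals requires integrability of each summand. It comes from square
  integrability on the bounded set \<Omega>, together with continuity of the test function and of
  its partial derivatives.\<close>

lemma has_weak_gradient_add_scale:
  assumes \<Omega>: "open \<Omega>" "bounded \<Omega>"
    and u: "has_weak_gradient \<Omega> u g" and w: "has_weak_gradient \<Omega> w h"
  shows "has_weak_gradient \<Omega> (\<lambda>x. u x + c * w x) (\<lambda>x. g x + c *s h x)"
  unfolding has_weak_gradient_def
proof (intro conjI allI impI)
  have L2: "u \<in> L2 (lebesgue_on \<Omega>)" "w \<in> L2 (lebesgue_on \<Omega>)"
    "g \<in> L2 (lebesgue_on \<Omega>)" "h \<in> L2 (lebesgue_on \<Omega>)"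
    using u w by (simp_all add: has_weak_gradient_def)
  show "(\<lambda>x. u x + c * w x) \<in> L2 (lebesgue_on \<Omega>)"
    by (intro L2_add L2 L2_bounded_linear[OF bounded_linear_mult_right])
  show "(\<lambda>x. g x + c *s h x) \<in> L2 (lebesgue_on \<Omega>)"
    by (intro L2_add L2 L2_bounded_linear[OF bounded_linear_vector_scalar_mult])
  fix \<phi> i assume \<phi>: "test_function \<Omega> \<phi>"
  have int: "integrable (lebesgue_on \<Omega>) (\<lambda>x. \<psi> x *\<^sub>R f x)"
    if "continuous_on UNIV \<psi>" "f \<in> L2 (lebesgue_on \<Omega>)" for \<psi> and f :: "real^'a \<Rightarrow> complex"
    using that \<Omega>
    by (intro integrable_continuous_scaleR L2_imp_integrable finite_measure_lebesgue_on_bounded_open)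
  have "(LINT x|lebesgue_on \<Omega>. partial i \<phi> x *\<^sub>R (u x + c * w x))
      = (LINT x|lebesgue_on \<Omega>. partial i \<phi> x *\<^sub>R u x + c * (partial i \<phi> x *\<^sub>R w x))"
    by (simp add: scaleR_add_right)
  also have "\<dots> = (LINT x|lebesgue_on \<Omega>. partial i \<phi> x *\<^sub>R u x)
      + c * (LINT x|lebesgue_on \<Omega>. partial i \<phi> x *\<^sub>R w x)"
    by (intro integral_add_scale int[OF test_function_partial_continuous[OF \<phi>]] L2)
  also have "\<dots> = - ((LINT x|lebesgue_on \<Omega>. \<phi> x *\<^sub>R (g x $ i))
      + c * (LINT x|lebesgue_on \<Omega>. \<phi> x *\<^sub>R (h x $ i)))"
    using u w \<phi> by (simp add: has_weak_gradient_def)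
  also have "\<dots> = - (LINT x|lebesgue_on \<Omega>. \<phi> x *\<^sub>R (g x $ i) + c * (\<phi> x *\<^sub>R (h x $ i)))"
    by (subst integral_add_scale) (intro int[OF test_function_continuous[OF \<phi>]] L2 L2_nth refl)+
  also have "\<dots> = - (LINT x|lebesgue_on \<Omega>. \<phi> x *\<^sub>R ((g x + c *s h x) $ i))"
    by (simp add: scaleR_add_right)
  finally show "(LINT x|lebesgue_on \<Omega>. partial i \<phi> x *\<^sub>R (u x + c * w x))
      = - (LINT x|lebesgue_on \<Omega>. \<phi> x *\<^sub>R ((g x + c *s h x) $ i))" .
qed

text \<open>Each coordinate of \<open>g - h\<close> integrates to 0 against every test function, so
  the fundamental lemma applies coordinatewise; finitely many null sets are united.\<close>

lemma has_weak_gradient_unique: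
  assumes \<Omega>: "open \<Omega>" "bounded \<Omega>"
    and g: "has_weak_gradient \<Omega> u g" and h: "has_weak_gradient \<Omega> u h"
  shows "AE x in lebesgue_on \<Omega>. g x = h x"
proof -
  have L2: "g \<in> L2 (lebesgue_on \<Omega>)" "h \<in> L2 (lebesgue_on \<Omega>)"
    using g h by (simp_all add: has_weak_gradient_def)
  have int: "integrable (lebesgue_on \<Omega>) (\<lambda>x. g x $ i)" "integrable (lebesgue_on \<Omega>) (\<lambda>x. h x $ i)" for i
    by (intro L2_imp_integrable finite_measure_lebesgue_on_bounded_open \<Omega> L2_nth L2)+
  have "AE x in lebesgue_on \<Omega>. g x $ i - h x $ i = 0" for i
  proof (rule fundamental_lemma_calculus_of_variations[OF \<Omega>(1)])
    show "integrable (lebesgue_on \<Omega>) (\<lambda>x. g x $ i - h x $ i)"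
      using int by simp
    fix \<phi> :: "real^'a \<Rightarrow> real" assume \<phi>: "test_function \<Omega> \<phi>"
    have "(LINT x|lebesgue_on \<Omega>. partial i \<phi> x *\<^sub>R u x) = - (LINT x|lebesgue_on \<Omega>. \<phi> x *\<^sub>R (g x $ i))"
      using g \<phi> unfolding has_weak_gradient_def by blast
    moreover have "(LINT x|lebesgue_on \<Omega>. partial i \<phi> x *\<^sub>R u x) = - (LINT x|lebesgue_on \<Omega>. \<phi> x *\<^sub>R (h x $ i))"
      using h \<phi> unfolding has_weak_gradient_def by blast
    ultimately have "(LINT x|lebesgue_on \<Omega>. \<phi> x *\<^sub>R (g x $ i)) = (LINT x|lebesgue_on \<Omega>. \<phi> x *\<^sub>R (h x $ i))"
      by simp
    then show "(LINT x|lebesgue_on \<Omega>. \<phi> x *\<^sub>R (g x $ i - h x $ i)) = 0"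
      by (simp add: scaleR_diff_right
          integrable_continuous_scaleR[OF \<Omega>(2) int(1) test_function_continuous[OF \<phi>]]
          integrable_continuous_scaleR[OF \<Omega>(2) int(2) test_function_continuous[OF \<phi>]])
  qed
  then have "AE x in lebesgue_on \<Omega>. \<forall>i. g x $ i - h x $ i = 0"
    using AE_finite_allI[of UNIV "\<lambda>i x. g x $ i - h x $ i = 0" "lebesgue_on \<Omega>"] by simp
  then show ?thesis
    by eventually_elim (simp add: vec_eq_iff)
qed

lemma H1_has_weak_gradient: "u \<in> H1 \<Omega> \<Longrightarrow> has_weak_gradient \<Omega> u (weak_grad \<Omega> u)"
  unfolding H1_def weak_grad_def by (simp add: someI_ex)

lemma H1_L2: "u \<in> H1 \<Omega> \<Longrightarrow> u \<in> L2 (lebesgue_on \<Omega>)"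
  by (auto simp: H1_def has_weak_gradient_def)

lemma H1_weak_grad_L2: "u \<in> H1 \<Omega> \<Longrightarrow> weak_grad \<Omega> u \<in> L2 (lebesgue_on \<Omega>)"
  using H1_has_weak_gradient has_weak_gradient_def by blast

lemma H1_cnj: "u \<in> H1 \<Omega> \<Longrightarrow> (\<lambda>x. cnj (u x)) \<in> H1 \<Omega>"
  unfolding H1_def using has_weak_gradient_cnj by blast

lemma H1_add_scale:
  "open \<Omega> \<Longrightarrow> bounded \<Omega> \<Longrightarrow> u \<in> H1 \<Omega> \<Longrightarrow> w \<in> H1 \<Omega> \<Longrightarrow> (\<lambda>x. u x + c * w x) \<in> H1 \<Omega>"
  unfolding H1_def using has_weak_gradient_add_scale by blast

text \<open>The three gradients are chosen independently of one another, but both sides are weak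
  gradients of the same function, so uniqueness identifies them up to a null set.\<close>

lemma weak_grad_add_scale:
  assumes "open \<Omega>" "bounded \<Omega>" "u \<in> H1 \<Omega>" "w \<in> H1 \<Omega>"
  shows "AE x in lebesgue_on \<Omega>. weak_grad \<Omega> (\<lambda>y. u y + c * w y) x = weak_grad \<Omega> u x + c *s weak_grad \<Omega> w x"
  by (rule has_weak_gradient_unique[OF assms(1,2) H1_has_weak_gradient[OF H1_add_scale[OF assms]]
        has_weak_gradient_add_scale[OF assms(1,2) assms(3,4)[THEN H1_has_weak_gradient]]])

section \<open>Square integrability and linearity of traces\<close>

lemma is_trace_operator_boundary_trace:
  "\<exists>T. is_trace_operator \<Omega> T \<Longrightarrow> is_trace_operator \<Omega> (boundary_trace \<Omega>)"
  by (simp add: boundary_trace_def someI_ex)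

text \<open>Both branches of the definition of \<open>boundary_trace\<close> are covered: a trace
  operator has the property by definition, and the default value 0 has it trivially. Linearity is
  handled by the same case distinction.\<close>

lemma boundary_trace_L2:
  assumes "u \<in> H1 \<Omega>"
  shows "boundary_trace \<Omega> u \<in> L2 (surface_measure \<Omega>)"
proof (cases "\<exists>T. is_trace_operator \<Omega> T")
  case True
  with assms show ?thesis
    using is_trace_operator_boundary_trace[OF True] by (simp add: is_trace_operator_def)
qed (simp add: boundary_trace_def L2_def)

lemma boundary_trace_add_scale:
  assumes "u \<in> H1 \<Omega>" "w \<in> H1 \<Omega>"
  shows "AE x in surface_measure \<Omega>.
    boundary_trace \<Omega> (\<lambda>y. u y + c * w y) x = boundary_trace \<Omega> u x + c * boundary_trace \<Omega> w x"
proof (cases "\<exists>T. is_trace_operator \<Omega> T")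
  case True
  with assms show ?thesis
    using is_trace_operator_boundary_trace[OF True] by (simp add: is_trace_operator_def)
qed (simp add: boundary_trace_def)


section \<open>The weak formulation as a derivative\<close>

text \<open>The left side of the weak formulation, with \<open>z\<close> in place of the conjugated
  test function. This makes it complex linear, rather than antilinear, in the second
  argument.\<close>

definition helmholtz_form ::
    "(real^'n) set \<Rightarrow> real \<Rightarrow> (real^'n \<Rightarrow> complex) \<Rightarrow> (real^'n \<Rightarrow> complex) \<Rightarrow> complex" where
  "helmholtz_form \<Omega> k u z =
     (LINT x|lebesgue_on \<Omega>. cdot (weak_grad \<Omega> u x) (weak_grad \<Omega> z x))
     - (of_real k)\<^sup>2 * (LINT x|lebesgue_on \<Omega>. u x * z x)
     - \<i> * of_real k * (LINT x|surface_measure \<Omega>. boundary_trace \<Omega> u x * boundary_trace \<Omega> z x)"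

text \<open>The gradient and the trace are linear only almost everywhere, so these two integrands
  are compared up to null sets, whereas the zero-order term splits pointwise.\<close>

lemma helmholtz_form_add_scale:
  assumes \<Omega>: "open \<Omega>" "bounded \<Omega>" and H1: "u \<in> H1 \<Omega>" "z \<in> H1 \<Omega>" "w \<in> H1 \<Omega>"
  shows "helmholtz_form \<Omega> k u (\<lambda>x. z x + c * w x) = helmholtz_form \<Omega> k u z + c * helmholtz_form \<Omega> k u w"
proof -
  let ?G = "weak_grad \<Omega>" and ?T = "boundary_trace \<Omega>" and ?zw = "\<lambda>x. z x + c * w x"
  note zw = H1_add_scale[OF \<Omega> H1(2,3), of c]
  note L2 = H1[THEN H1_L2] and G = H1[THEN H1_weak_grad_L2] and T = H1[THEN boundary_trace_L2]
  have "(LINT x|lebesgue_on \<Omega>. cdot (?G u x) (?G ?zw x))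
      = (LINT x|lebesgue_on \<Omega>. cdot (?G u x) (?G z x) + c * cdot (?G u x) (?G w x))"
  proof (rule integral_cong_AE)
    show "AE x in lebesgue_on \<Omega>. cdot (?G u x) (?G ?zw x)
        = cdot (?G u x) (?G z x) + c * cdot (?G u x) (?G w x)"
      using weak_grad_add_scale[OF \<Omega> H1(2,3), of c] by eventually_elim (simp add: cdot_add_scale)
  \<comment> \<open>\<open>integral_cong_AE\<close> also asks for measurability of both integrands,
    which is read off from their integrability.\<close>
  qed (use L2_cdot_integrable[OF G(1) G(2)] L2_cdot_integrable[OF G(1) G(3)]
         L2_cdot_integrable[OF G(1) H1_weak_grad_L2[OF zw]] in auto)
  then have grad: "(LINT x|lebesgue_on \<Omega>. cdot (?G u x) (?G ?zw x))
      = (LINT x|lebesgue_on \<Omega>. cdot (?G u x) (?G z x)) + c * (LINT x|lebesgue_on \<Omega>. cdot (?G u x) (?G w x))"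
    by (simp add: L2_cdot_integrable G)
  have "(LINT x|surface_measure \<Omega>. ?T u x * ?T ?zw x)
      = (LINT x|surface_measure \<Omega>. ?T u x * ?T z x + c * (?T u x * ?T w x))"
  proof (rule integral_cong_AE)
    show "AE x in surface_measure \<Omega>. ?T u x * ?T ?zw x = ?T u x * ?T z x + c * (?T u x * ?T w x)"
      using boundary_trace_add_scale[OF H1(2,3), of c] by eventually_elim (simp add: algebra_simps)
  qed (use L2_mult_integrable[OF T(1) T(2)] L2_mult_integrable[OF T(1) T(3)]
         L2_mult_integrable[OF T(1) boundary_trace_L2[OF zw]] in auto)
  then have trace: "(LINT x|surface_measure \<Omega>. ?T u x * ?T ?zw x)
      = (LINT x|surface_measure \<Omega>. ?T u x * ?T z x) + c * (LINT x|surface_measure \<Omega>. ?T u x * ?T w x)"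
    by (simp add: L2_mult_integrable T)
  have "(LINT x|lebesgue_on \<Omega>. u x * ?zw x) = (LINT x|lebesgue_on \<Omega>. u x * z x + c * (u x * w x))"
    by (simp add: algebra_simps)
  also have "\<dots> = (LINT x|lebesgue_on \<Omega>. u x * z x) + c * (LINT x|lebesgue_on \<Omega>. u x * w x)"
    by (simp add: L2_mult_integrable L2)
  finally show ?thesis
    by (simp add: helmholtz_form_def grad trace algebra_simps)
qed

text \<open>Every term of the energy carries the factor 1/2, the source terms because the real part
  is a half sum. The term with \<open>cnj (f x)\<close> does not involve \<open>z\<close>, so it
  drops out when \<open>z\<close> is varied.\<close>

lemma energy2_helmholtz_form:
  assumes "u \<in> H1 \<Omega>" "z \<in> H1 \<Omega>"
  shows "energy2 \<Omega> k f u z = 1/2 * (helmholtz_form \<Omega> k u z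
      - (LINT x|lebesgue_on \<Omega>. f x * z x) - (LINT x|lebesgue_on \<Omega>. cnj (f x) * u x))"
proof -
  note int = L2_cdot_integrable[OF assms[THEN H1_weak_grad_L2]] L2_mult_integrable[OF assms[THEN H1_L2]]
  have "(LINT x|lebesgue_on \<Omega>. 1/2 * (cdot (weak_grad \<Omega> u x) (weak_grad \<Omega> z x) - (of_real k)\<^sup>2 * u x * z x))
     = 1/2 * (LINT x|lebesgue_on \<Omega>. cdot (weak_grad \<Omega> u x) (weak_grad \<Omega> z x) + - (of_real k)\<^sup>2 * (u x * z x))"
    unfolding integral_mult_right_zero by (simp add: mult.assoc)
  also have "\<dots> = 1/2 * ((LINT x|lebesgue_on \<Omega>. cdot (weak_grad \<Omega> u x) (weak_grad \<Omega> z x))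
     + - (of_real k)\<^sup>2 * (LINT x|lebesgue_on \<Omega>. u x * z x))"
    using int by (subst integral_add_scale) simp_all
  finally show ?thesis
    unfolding energy2_def helmholtz_form_def by (simp only:) (simp add: algebra_simps)
qed

lemma stationary_imp_weak_form:
  assumes \<Omega>: "open \<Omega>" "bounded \<Omega>" and f: "f \<in> L2 (lebesgue_on \<Omega>)"
    and stat: "stationary_wrt_conj \<Omega> k f u" and v: "v \<in> H1 \<Omega>"
  shows "helmholtz_form \<Omega> k u (\<lambda>x. cnj (v x)) = (LINT x|lebesgue_on \<Omega>. f x * cnj (v x))"
proof -
  let ?w = "\<lambda>x. cnj (v x)" and ?z = "\<lambda>x. cnj (u x)"
  \<comment> \<open>The slope of the energy along the direction \<open>?w\<close>; its vanishing is
    the weak formulation.\<close>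
  let ?D = "1/2 * (helmholtz_form \<Omega> k u ?w - (LINT x|lebesgue_on \<Omega>. f x * ?w x))"
  have u: "u \<in> H1 \<Omega>" using stat by (simp add: stationary_wrt_conj_def)
  note H1 = u H1_cnj[OF u] H1_cnj[OF v]
  have affine: "energy2 \<Omega> k f u (\<lambda>x. ?z x + of_real \<epsilon> * ?w x) = energy2 \<Omega> k f u ?z + \<epsilon> *\<^sub>R ?D"
    for \<epsilon> :: real
  proof -
    have "(LINT x|lebesgue_on \<Omega>. f x * (?z x + of_real \<epsilon> * ?w x))
        = (LINT x|lebesgue_on \<Omega>. f x * ?z x + of_real \<epsilon> * (f x * ?w x))"
      by (simp add: algebra_simps)
    also have "\<dots> = (LINT x|lebesgue_on \<Omega>. f x * ?z x) + of_real \<epsilon> * (LINT x|lebesgue_on \<Omega>. f x * ?w x)"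
      by (intro integral_add_scale L2_mult_integrable f H1_L2 H1)
    finally show ?thesis
      unfolding energy2_helmholtz_form[OF u H1(2)] energy2_helmholtz_form[OF u H1_add_scale[OF \<Omega> H1(2,3)]]
        helmholtz_form_add_scale[OF \<Omega> H1]
      by (simp only: scaleR_conv_of_real) (simp add: algebra_simps)
  qed
  have "((\<lambda>\<epsilon>. energy2 \<Omega> k f u ?z + \<epsilon> *\<^sub>R ?D) has_vector_derivative ?D) (at 0)"
    by (auto intro!: derivative_eq_intros)
  \<comment> \<open>Stationarity is used with \<open>w = v\<close>: its definition conjugates
    \<open>w\<close>, so the direction is exactly \<open>?w\<close>.\<close>
  moreover have "((\<lambda>\<epsilon>. energy2 \<Omega> k f u ?z + \<epsilon> *\<^sub>R ?D) has_vector_derivative 0) (at 0)"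
    using stat v unfolding stationary_wrt_conj_def affine[symmetric] by blast
  ultimately have "?D = 0"
    by (rule vector_derivative_unique_at)
  then show ?thesis by simp
qed

theorem proposition3p2:
  fixes \<Omega> :: "(real^'n) set" and k :: real and f u :: "real^'n \<Rightarrow> complex"
  assumes "bounded_lipschitz_domain \<Omega>"
    and "k > 0"
    and "f \<in> L2 (lebesgue_on \<Omega>)"
    and "stationary_wrt_conj \<Omega> k f u"
  shows "(\<forall>v \<in> H1 \<Omega>.
            (LINT x|lebesgue_on \<Omega>. cdot (weak_grad \<Omega> u x) (weak_grad \<Omega> (\<lambda>y. cnj (v y)) x))
            - (of_real k)\<^sup>2 * (LINT x|lebesgue_on \<Omega>. u x * cnj (v x))
            - \<i> * of_real k *
                (LINT x|surface_measure \<Omega>. boundary_trace \<Omega> u x * boundary_trace \<Omega> (\<lambda>y. cnj (v y)) x)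
            = (LINT x|lebesgue_on \<Omega>. f x * cnj (v x)))
       \<and> weak_neumann_solution \<Omega> (\<lambda>x. (of_real k)\<^sup>2 * u x + f x)
           (\<lambda>x. \<i> * of_real k * boundary_trace \<Omega> u x) u"
proof (rule conjI)
  have \<Omega>: "open \<Omega>" "bounded \<Omega>"
    using assms(1) by (auto simp: bounded_lipschitz_domain_def)
  have u: "u \<in> H1 \<Omega>" using assms(4) by (simp add: stationary_wrt_conj_def)
  show weak: "\<forall>v \<in> H1 \<Omega>.
            (LINT x|lebesgue_on \<Omega>. cdot (weak_grad \<Omega> u x) (weak_grad \<Omega> (\<lambda>y. cnj (v y)) x))
            - (of_real k)\<^sup>2 * (LINT x|lebesgue_on \<Omega>. u x * cnj (v x))
            - \<i> * of_real k *
                (LINT x|surface_measure \<Omega>. boundary_trace \<Omega> u x * boundary_trace \<Omega> (\<lambda>y. cnj (v y)) x)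
            = (LINT x|lebesgue_on \<Omega>. f x * cnj (v x))"
    using stationary_imp_weak_form[OF \<Omega> assms(3,4)] unfolding helmholtz_form_def by blast
  \<comment> \<open>The Helmholtz equation is read as a Poisson equation with source k^2 u + f and
    Neumann datum i k u; splitting this source recovers the two volume terms of the weak
    formulation.\<close>
  have source: "(LINT x|lebesgue_on \<Omega>. ((of_real k)\<^sup>2 * u x + f x) * cnj (v x))
      = (of_real k)\<^sup>2 * (LINT x|lebesgue_on \<Omega>. u x * cnj (v x)) + (LINT x|lebesgue_on \<Omega>. f x * cnj (v x))"
    if "v \<in> H1 \<Omega>" for v
  proof -
    note v = H1_L2[OF H1_cnj[OF that]]
    have "(LINT x|lebesgue_on \<Omega>. ((of_real k)\<^sup>2 * u x + f x) * cnj (v x))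
      = (LINT x|lebesgue_on \<Omega>. (of_real k)\<^sup>2 * (u x * cnj (v x)) + f x * cnj (v x))"
      by (simp add: algebra_simps)
    then show ?thesis
      using L2_mult_integrable[OF H1_L2[OF u] v] L2_mult_integrable[OF assms(3) v] by simp
  qed
  show "weak_neumann_solution \<Omega> (\<lambda>x. (of_real k)\<^sup>2 * u x + f x)
           (\<lambda>x. \<i> * of_real k * boundary_trace \<Omega> u x) u"
    unfolding weak_neumann_solution_def
  proof (intro conjI u ballI)
    fix v assume v: "v \<in> H1 \<Omega>"
    show "(LINT x|lebesgue_on \<Omega>. cdot (weak_grad \<Omega> u x) (weak_grad \<Omega> (\<lambda>y. cnj (v y)) x)) =
        (LINT x|lebesgue_on \<Omega>. ((of_real k)\<^sup>2 * u x + f x) * cnj (v x)) +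
        (LINT x|surface_measure \<Omega>. \<i> * of_real k * boundary_trace \<Omega> u x * boundary_trace \<Omega> (\<lambda>y. cnj (v y)) x)"
      unfolding source[OF v] mult.assoc[of "\<i> * of_real k"] integral_mult_right_zero
      using bspec[OF weak v] by (simp only: diff_eq_eq add_ac)
  qed
qed

end
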